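(* Let $B_\delta\subset\mathbb{R}^{\mathcal{J}}$ be a set mapped into itself by both $\Phi^{\delta,0}$ and $\Phi^{\delta,1}$, suppose that $\Phi^{\delta,0}$ is a contraction on $B_\delta$ in the sup norm with modulus $\eta_0\in(0,1)$, and let $\delta_*\in B_\delta$ be the solution of $S_j^{(data)}=s_j(\delta_* )$ for all $j\in\mathcal{J}$. Let $\eta\in(0,1)$, let $m(\delta)=\left\Vert \left(\log S_j^{(data)}-\log s_j(\delta)\right)_{j\in\mathcal{J}}\right\Vert_\infty$, and for an arbitrary initial value $\delta^{(0)}\in B_\delta$ define recursively, for $n=0,1,2,\dots$, $$\delta^{(n+1)}=\begin{cases}\Phi^{\delta,1}(\delta^{(n)}) & \text{if } m\left(\Phi^{\delta,1}(\delta^{(n)})\right)\leq\eta\, m(\delta^{(n)}),\\ \Phi^{\delta,0}(\delta^{(n)}) & \text{otherwise.}\end{cases}$$ Then $\lim_{n\to\infty}\delta^{(n)}=\delta_*$.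
   Context: Static random coefficient logit (BLP) model. $\mathcal{J}$ (products) and $\mathcal{I}$ (consumer types) are finite nonempty sets; $w_i\ge 0$ ($i\in\mathcal{I}$) with $\sum_{i\in\mathcal{I}}w_i=1$; $\mu_{ij}\in\mathbb{R}$ are given. The observed shares $S_j^{(data)}>0$ ($j\in\mathcal{J}$) and $S_0^{(data)}>0$ satisfy $S_0^{(data)}+\sum_{j\in\mathcal{J}}S_j^{(data)}=1$. For $\delta\in\mathbb{R}^{\mathcal{J}}$, $$s_j(\delta)=\sum_{i\in\mathcal{I}}w_i\frac{\exp(\delta_j+\mu_{ij})}{1+\sum_{k\in\mathcal{J}}\exp(\delta_k+\mu_{ik})},\qquad s_0(\delta)=1-\sum_{k\in\mathcal{J}}s_k(\delta),$$ $$\Phi_j^{\delta,\gamma}(\delta)=\delta_j+[\log S_j^{(data)}-\log s_j(\delta)]-\gamma[\log S_0^{(data)}-\log s_0(\delta)]\qquad(\gamma\in\mathbb{R}).$$ The superscript $\delta$ on $\Phi$ is only a label. $\Vert\cdot\Vert_\infty$ is the sup norm. "Contraction on $B_\delta$ with modulus $\eta_0$" means $\Vert\Phi^{\delta,0}(\delta)-\Phi^{\delta,0}(\delta')\Vert_\infty\le\eta_0\Vert\delta-\delta'\Vert_\infty$ for all $\delta,\delta'\in B_\delta$. *)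

theory Defs
  imports "HOL-Analysis.Analysis"
begin

text \<open>
  The finite nonempty sets of products and of consumer types are the universes of the
  type variables \<open>'j\<close> and \<open>'i\<close> of class \<open>finite\<close>. The sup norm on
  \<open>real ^ 'j\<close> is the library's \<open>infnorm\<close>; \<open>norm\<close> would be the Euclidean norm.
\<close>

definition share ::
  "('i::finite \<Rightarrow> real) \<Rightarrow> ('i \<Rightarrow> 'j::finite \<Rightarrow> real) \<Rightarrow> real ^ 'j \<Rightarrow> 'j \<Rightarrow> real" where
  "share w \<mu> \<delta> j =
     (\<Sum>i\<in>UNIV. w i * (exp (\<delta> $ j + \<mu> i j) / (1 + (\<Sum>k\<in>UNIV. exp (\<delta> $ k + \<mu> i k)))))"

definition outside_share ::
  "('i::finite \<Rightarrow> real) \<Rightarrow> ('i \<Rightarrow> 'j::finite \<Rightarrow> real) \<Rightarrow> real ^ 'j \<Rightarrow> real" where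
  "outside_share w \<mu> \<delta> = 1 - (\<Sum>k\<in>UNIV. share w \<mu> \<delta> k)"

definition \<Phi> ::
  "('i::finite \<Rightarrow> real) \<Rightarrow> ('i \<Rightarrow> 'j::finite \<Rightarrow> real) \<Rightarrow> ('j \<Rightarrow> real) \<Rightarrow> real \<Rightarrow> real
    \<Rightarrow> real ^ 'j \<Rightarrow> real ^ 'j" where
  "\<Phi> w \<mu> S S0 \<gamma> \<delta> =
     (\<chi> j. \<delta> $ j + (ln (S j) - ln (share w \<mu> \<delta> j))
            - \<gamma> * (ln S0 - ln (outside_share w \<mu> \<delta>)))"

definition log_share_gap ::
  "('i::finite \<Rightarrow> real) \<Rightarrow> ('i \<Rightarrow> 'j::finite \<Rightarrow> real) \<Rightarrow> ('j \<Rightarrow> real) \<Rightarrow> real ^ 'j \<Rightarrow> real" where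
  "log_share_gap w \<mu> S \<delta> = infnorm (\<chi> j. ln (S j) - ln (share w \<mu> \<delta> j))"

end

theory Submission
  imports Defs
begin

text \<open>
  The gap \<open>m\<close> is the displacement of \<open>\<Phi>\<^sup>0\<close>, that is, \<open>m x = \<parallel>\<Phi>\<^sup>0 x - x\<parallel>\<close>. Hence a contraction step shrinks \<open>m\<close>
  by \<open>\<eta>\<^sub>0\<close>, an accepted \<open>\<Phi>\<^sup>1\<close> step shrinks it by \<open>\<eta>\<close>, and \<open>m\<close> tends to \<open>0\<close> geometrically along the
  iterates. Since \<open>m x\<close> bounds \<open>(1 - \<eta>\<^sub>0) * \<parallel>x - \<delta>\<^sub>*\<parallel>\<close>, the iterates converge, however \<open>\<Phi>\<^sup>1\<close> behaves.
\<close>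

text \<open>At \<open>\<gamma> = 0\<close> the outside-share term of \<open>\<Phi>\<close> vanishes,
  leaving \<open>x\<close> plus the vector of log-share gaps.\<close>

lemma log_share_gap_eq_displacement:
  "log_share_gap w \<mu> S x = infnorm (\<Phi> w \<mu> S S0 0 x - x)"
proof -
  have "(\<chi> j. ln (S j) - ln (share w \<mu> x j)) = \<Phi> w \<mu> S S0 0 x - x"
    by (simp add: \<Phi>_def vec_eq_iff)
  then show ?thesis
    by (simp add: log_share_gap_def)
qed

lemma \<Phi>_0_fixed_point:
  assumes "\<And>j. S j = share w \<mu> x j"
  shows "\<Phi> w \<mu> S S0 0 x = x"
  using assms by (simp add: \<Phi>_def vec_eq_iff)

text \<open>Triangle inequality through \<open>f x\<close>: as \<open>p\<close> is fixed, the
  contraction bound on \<open>f x - p\<close> can be absorbed on the left. This turns a small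
  displacement into closeness to \<open>p\<close>.\<close>

lemma infnorm_dist_fixed_point_le:
  assumes "infnorm (f x - f p) \<le> c * infnorm (x - p)" and "f p = p"
  shows "(1 - c) * infnorm (x - p) \<le> infnorm (f x - x)"
proof -
  have "infnorm (x - p) \<le> infnorm (x - f x) + infnorm (f x - p)"
    using infnorm_triangle[of "x - f x" "f x - p"] by simp
  also have "infnorm (x - f x) = infnorm (f x - x)"
    by (rule infnorm_sub)
  finally show ?thesis
    using assms by (simp add: algebra_simps)
qed

text \<open>The Euclidean norm, which defines the limit, is at most \<open>sqrt DIM('a)\<close>
  times \<open>infnorm\<close>.\<close>

lemma tendsto_infnormI:
  fixes f :: "'b \<Rightarrow> 'a::euclidean_space"
  assumes "((\<lambda>n. infnorm (f n - l)) \<longlongrightarrow> 0) F"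
  shows "(f \<longlongrightarrow> l) F"
proof -
  have "((\<lambda>n. sqrt DIM('a) * infnorm (f n - l)) \<longlongrightarrow> 0) F"
    using tendsto_mult_right_zero[OF assms] .
  then have "((\<lambda>n. f n - l) \<longlongrightarrow> 0) F"
    by (rule Lim_null_comparison[rotated]) (simp add: norm_le_infnorm)
  then show ?thesis
    by (simp add: LIM_zero_iff)
qed

theorem mainTheorem5:
  fixes w :: "'i::finite \<Rightarrow> real" and \<mu> :: "'i \<Rightarrow> 'j::finite \<Rightarrow> real"
    and S :: "'j \<Rightarrow> real" and S0 :: real
    and B :: "(real ^ 'j) set" and \<delta>star :: "real ^ 'j"
    and \<eta>0 \<eta> :: real and \<delta> :: "nat \<Rightarrow> real ^ 'j"
  assumes w_nonneg: "\<And>i. w i \<ge> 0" and w_sum: "(\<Sum>i\<in>UNIV. w i) = 1"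
    and S_pos: "\<And>j. S j > 0" and S0_pos: "S0 > 0"
    and S_sum: "S0 + (\<Sum>j\<in>UNIV. S j) = 1"
    and maps0: "\<And>x. x \<in> B \<Longrightarrow> \<Phi> w \<mu> S S0 0 x \<in> B"
    and maps1: "\<And>x. x \<in> B \<Longrightarrow> \<Phi> w \<mu> S S0 1 x \<in> B"
    and \<eta>0: "0 < \<eta>0" "\<eta>0 < 1"
    and contraction: "\<And>x y. x \<in> B \<Longrightarrow> y \<in> B \<Longrightarrow>
           infnorm (\<Phi> w \<mu> S S0 0 x - \<Phi> w \<mu> S S0 0 y) \<le> \<eta>0 * infnorm (x - y)"
    and \<delta>star_in: "\<delta>star \<in> B" and \<delta>star: "\<And>j. S j = share w \<mu> \<delta>star j"
    and \<eta>: "0 < \<eta>" "\<eta> < 1"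
    and init: "\<delta> 0 \<in> B"
    and step: "\<And>n. \<delta> (Suc n) =
           (if log_share_gap w \<mu> S (\<Phi> w \<mu> S S0 1 (\<delta> n)) \<le> \<eta> * log_share_gap w \<mu> S (\<delta> n)
            then \<Phi> w \<mu> S S0 1 (\<delta> n)
            else \<Phi> w \<mu> S S0 0 (\<delta> n))"
  shows "\<delta> \<longlonglongrightarrow> \<delta>star"
proof -
  define m where "m = log_share_gap w \<mu> S"
  \<comment> \<open>One rate that serves both branches of the recursion.\<close>
  define q where "q = max \<eta> \<eta>0"
  have q: "0 < q" "q < 1"
    using \<eta> \<eta>0 by (auto simp: q_def)
  have m_eq: "m x = infnorm (\<Phi> w \<mu> S S0 0 x - x)" for x
    unfolding m_def by (rule log_share_gap_eq_displacement)
  have m_nonneg: "0 \<le> m x" for x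
    by (simp add: m_eq infnorm_pos_le)
  have in_B: "\<delta> n \<in> B" for n
    by (induction n) (simp_all add: init step maps0 maps1)
  have decrease: "m (\<delta> (Suc n)) \<le> q * m (\<delta> n)" for n
  proof (cases "m (\<Phi> w \<mu> S S0 1 (\<delta> n)) \<le> \<eta> * m (\<delta> n)")
    case True
    then have "m (\<delta> (Suc n)) \<le> \<eta> * m (\<delta> n)"
      by (simp add: step m_def)
    also have "\<dots> \<le> q * m (\<delta> n)"
      by (intro mult_right_mono m_nonneg) (simp add: q_def)
    finally show ?thesis .
  next
    case False
    then have "m (\<delta> (Suc n)) = m (\<Phi> w \<mu> S S0 0 (\<delta> n))"
      by (simp add: step m_def)
    \<comment> \<open>Contraction for the pair \<open>\<Phi> w \<mu> S S0 0 (\<delta> n)\<close> and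
      \<open>\<delta> n\<close>, both in \<open>B\<close>: the displacement at the image is a
      difference of images.\<close>
    also have "\<dots> \<le> \<eta>0 * m (\<delta> n)"
      unfolding m_eq by (intro contraction maps0 in_B)
    also have "\<dots> \<le> q * m (\<delta> n)"
      by (intro mult_right_mono m_nonneg) (simp add: q_def)
    finally show ?thesis .
  qed
  have geometric: "m (\<delta> n) \<le> q ^ n * m (\<delta> 0)" for n
  proof (induction n)
    case (Suc n)
    have "m (\<delta> (Suc n)) \<le> q * m (\<delta> n)"
      by (rule decrease)
    also have "\<dots> \<le> q * (q ^ n * m (\<delta> 0))"
      using Suc q by (intro mult_left_mono) auto
    finally show ?case
      by (simp add: mult.assoc)
  qed simp
  have bound: "infnorm (\<delta> n - \<delta>star) \<le> q ^ n * (m (\<delta> 0) / (1 - \<eta>0))" for n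
  proof -
    \<comment> \<open>Here contraction is used between \<open>\<delta> n\<close> and the fixed point
      \<open>\<delta>star\<close>, whichever branch produced \<open>\<delta> n\<close>.\<close>
    have "(1 - \<eta>0) * infnorm (\<delta> n - \<delta>star) \<le> m (\<delta> n)"
      unfolding m_eq
      by (intro infnorm_dist_fixed_point_le contraction in_B \<delta>star_in \<Phi>_0_fixed_point \<delta>star)
    also note geometric
    finally show ?thesis
      using \<eta>0 by (simp add: field_simps)
  qed
  have "(\<lambda>n. q ^ n * (m (\<delta> 0) / (1 - \<eta>0))) \<longlonglongrightarrow> 0"
    using q by (intro tendsto_mult_left_zero LIMSEQ_realpow_zero) auto
  then have "(\<lambda>n. infnorm (\<delta> n - \<delta>star)) \<longlonglongrightarrow> 0"
    by (rule Lim_null_comparison[rotated]) (use bound in \<open>auto simp: infnorm_pos_le intro: always_eventually\<close>)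
  then show ?thesis
    by (rule tendsto_infnormI)
qed

end
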